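(* Let $G$ be a self-similar group over a finite alphabet $X$, let $S$ be the associated inverse semigroup and let $K$ be a field. Suppose $I_K(S)\setminus\mathcal T_K(S)\neq\emptyset$. Then $I_K(S)\setminus\mathcal T_K(S)$ intersects the group algebra $KG\subseteq K_0S$.
   Context: $X$ is a finite alphabet with $|X|\ge 2$; $X^*$ is the free monoid on $X$ (empty word $\varepsilon$). A self-similar group over $X$ is a group $G$ with a faithful action on $X^*$ by length-preserving permutations such that for all $g\in G$, $x\in X$ there is $g|_x\in G$ (the section of $g$ at $x$) with $g(xw)=g(x)\,g|_x(w)$ for all $w\in X^*$. Put $g|_\varepsilon=g$, $g|_{xv}=(g|_x)|_v$. The associated inverse semigroup $S$ consists of $0$ and all (formally distinct) elements $ugv^*$ with $u,v\in X^*$, $g\in G$, with product $(ugv^* )(whz^* )=u\,g(w')\,g|_{w'}h\,z^*$ if $w=vw'$; $(ugv^* )(whz^* )=u\,g\,h|_{h^{-1}(v')}\,(z\,h^{-1}(v'))^*$ if $v=wv'$; and $0$ if $v,w$ are not prefix-comparable. $G$ is identified with the elements $\varepsilon g\varepsilon^*$ of $S$. The nonzero idempotents are the $ww^*$, $w\in X^*$, and $E(S)$ is the semilattice of idempotents ($e\le f$ iff $ef=e$). $K_0S$ is the contracted semigroup algebra: the $K$-algebra with basis $S\setminus\{0\}$, with multiplication extending that of $S$ and the zero of $S$ identified with $0$. The singular ideal $I_K(S)$ is the set of $a\in K_0S$ such that for all $0\ne e\in E(S)$ there is $0\neq f\in E(S)$ with $f\le e$ and $af=0$. A set $F\subseteq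 E(S)$ covers $e\in E(S)$ if $f\le e$ for all $f\in F$ and whenever $0\ne f'\le e$ in $E(S)$, then $f'f\neq 0$ for some $f\in F$. The tight ideal $\mathcal T_K(S)$ is the two-sided ideal of $K_0S$ generated by all products $\prod_{f\in F}(e-f)$ with $e\in E(S)$ and $F\subseteq E(S)$ a finite cover of $e$. *)

theory Defs
  imports "HOL-Algebra.Algebra" "HOL-Library.Poly_Mapping" "HOL-Library.Sublist"
begin

section \<open>Self-similar groups\<close>

text \<open>
  The alphabet is the finite type \<open>'x\<close> and words are lists, so the action is on
  \<^term>\<open>UNIV :: 'x list set\<close>.  Note that \<open>\<phi> g [x]\<close> is a word of length one,
  namely the letter \<open>g(x)\<close>.
\<close>

locale self_similar_group =
  faithful_action G "UNIV :: 'x::finite list set" \<phi>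
  for G (structure) and \<phi> :: "'g \<Rightarrow> 'x::finite list \<Rightarrow> 'x list" +
  assumes card_alphabet: "card (UNIV :: 'x set) \<ge> 2"
    and length_preserving: "g \<in> carrier G \<Longrightarrow> length (\<phi> g w) = length w"
    and section_exists:
      "g \<in> carrier G \<Longrightarrow> \<exists>h \<in> carrier G. \<forall>w. \<phi> g (x # w) = \<phi> g [x] @ \<phi> h w"

definition letter_section ::
    "('g, 'm) monoid_scheme \<Rightarrow> ('g \<Rightarrow> 'x list \<Rightarrow> 'x list) \<Rightarrow> 'g \<Rightarrow> 'x \<Rightarrow> 'g" where
  "letter_section G \<phi> g x =
     (THE h. h \<in> carrier G \<and> (\<forall>w. \<phi> g (x # w) = \<phi> g [x] @ \<phi> h w))"

fun word_section ::
    "('g, 'm) monoid_scheme \<Rightarrow> ('g \<Rightarrow> 'x list \<Rightarrow> 'x list) \<Rightarrow> 'g \<Rightarrow> 'x list \<Rightarrow> 'g" where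
  "word_section G \<phi> g [] = g"
| "word_section G \<phi> g (x # v) = word_section G \<phi> (letter_section G \<phi> g x) v"

section \<open>The associated inverse semigroup\<close>

text \<open>\<open>SEl u g v\<close> stands for \<open>u g v\<^sup>*\<close>.\<close>

datatype ('x, 'g) ssg_elem = SZero | SEl "'x list" 'g "'x list"

definition ssg_carrier :: "('g, 'm) monoid_scheme \<Rightarrow> ('x, 'g) ssg_elem set" where
  "ssg_carrier G = insert SZero {SEl u g v | u g v. g \<in> carrier G}"

text \<open>
  If \<open>v = w\<close> both the first and the second case of the product apply and they agree.
\<close>

fun ssg_mult ::
    "('g, 'm) monoid_scheme \<Rightarrow> ('g \<Rightarrow> 'x list \<Rightarrow> 'x list) \<Rightarrow>
     ('x, 'g) ssg_elem \<Rightarrow> ('x, 'g) ssg_elem \<Rightarrow> ('x, 'g) ssg_elem" where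
  "ssg_mult G \<phi> (SEl u g v) (SEl w h z) =
    (if prefix v w then
       (let w' = drop (length v) w
        in SEl (u @ \<phi> g w') (word_section G \<phi> g w' \<otimes>\<^bsub>G\<^esub> h) z)
     else if prefix w v then
       (let v' = \<phi> (inv\<^bsub>G\<^esub> h) (drop (length w) v)
        in SEl u (g \<otimes>\<^bsub>G\<^esub> word_section G \<phi> h v') (z @ v'))
     else SZero)"
| "ssg_mult G \<phi> SZero t = SZero"
| "ssg_mult G \<phi> s SZero = SZero"

definition ssg_idem ::
    "('g, 'm) monoid_scheme \<Rightarrow> ('g \<Rightarrow> 'x list \<Rightarrow> 'x list) \<Rightarrow> ('x, 'g) ssg_elem set" where
  "ssg_idem G \<phi> = {e \<in> ssg_carrier G. ssg_mult G \<phi> e e = e}"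

definition ssg_le ::
    "('g, 'm) monoid_scheme \<Rightarrow> ('g \<Rightarrow> 'x list \<Rightarrow> 'x list) \<Rightarrow>
     ('x, 'g) ssg_elem \<Rightarrow> ('x, 'g) ssg_elem \<Rightarrow> bool" where
  "ssg_le G \<phi> e f \<longleftrightarrow> ssg_mult G \<phi> e f = e"

definition ssg_covers ::
    "('g, 'm) monoid_scheme \<Rightarrow> ('g \<Rightarrow> 'x list \<Rightarrow> 'x list) \<Rightarrow>
     ('x, 'g) ssg_elem set \<Rightarrow> ('x, 'g) ssg_elem \<Rightarrow> bool" where
  "ssg_covers G \<phi> F e \<longleftrightarrow>
     F \<subseteq> ssg_idem G \<phi> \<and>
     (\<forall>f\<in>F. ssg_le G \<phi> f e) \<and>
     (\<forall>f'\<in>ssg_idem G \<phi>. f' \<noteq> SZero \<longrightarrow> ssg_le G \<phi> f' e \<longrightarrow>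
        (\<exists>f\<in>F. ssg_mult G \<phi> f' f \<noteq> SZero))"

section \<open>The contracted semigroup algebra\<close>

text \<open>
  Elements of \<open>K\<^sub>0S\<close> are finitely supported functions from \<open>S - {0}\<close> to \<open>K\<close>;
  \<open>ssg_scaled c s\<close> is \<open>c \<cdot> s\<close>, with the zero of \<open>S\<close> identified with \<open>0\<close>.
\<close>

definition ssg_scaled :: "'k::field \<Rightarrow> ('x, 'g) ssg_elem \<Rightarrow> ('x, 'g) ssg_elem \<Rightarrow>\<^sub>0 'k" where
  "ssg_scaled c s = (if s = SZero then 0 else Poly_Mapping.single s c)"

definition contracted_algebra ::
    "('g, 'm) monoid_scheme \<Rightarrow> ('g \<Rightarrow> 'x list \<Rightarrow> 'x list) \<Rightarrow>
     (('x, 'g) ssg_elem \<Rightarrow>\<^sub>0 'k::field) ring" where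
  "contracted_algebra G \<phi> =
     \<lparr> carrier = {a. Poly_Mapping.keys a \<subseteq> ssg_carrier G - {SZero}},
       monoid.mult = (\<lambda>a b. \<Sum>s\<in>Poly_Mapping.keys a. \<Sum>t\<in>Poly_Mapping.keys b.
                 ssg_scaled (Poly_Mapping.lookup a s * Poly_Mapping.lookup b t)
                            (ssg_mult G \<phi> s t)),
       monoid.one = ssg_scaled 1 (SEl [] \<one>\<^bsub>G\<^esub> []),
       ring.zero = 0,
       ring.add = (+) \<rparr>"

definition group_algebra ::
    "('g, 'm) monoid_scheme \<Rightarrow> (('x, 'g) ssg_elem \<Rightarrow>\<^sub>0 'k::field) set" where
  "group_algebra G = {a. Poly_Mapping.keys a \<subseteq> {SEl [] g [] | g. g \<in> carrier G}}"

definition singular_ideal ::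
    "('g, 'm) monoid_scheme \<Rightarrow> ('g \<Rightarrow> 'x list \<Rightarrow> 'x list) \<Rightarrow>
     (('x, 'g) ssg_elem \<Rightarrow>\<^sub>0 'k::field) set" where
  "singular_ideal G \<phi> =
     {a \<in> carrier (contracted_algebra G \<phi>).
        \<forall>e\<in>ssg_idem G \<phi>. e \<noteq> SZero \<longrightarrow>
          (\<exists>f\<in>ssg_idem G \<phi>. f \<noteq> SZero \<and> ssg_le G \<phi> f e \<and>
             a \<otimes>\<^bsub>contracted_algebra G \<phi>\<^esub> ssg_scaled 1 f = \<zero>\<^bsub>contracted_algebra G \<phi>\<^esub>)}"

text \<open>
  The product of the \<open>e - f\<close> over a finite set \<open>F\<close> of idempotents below \<open>e\<close>, taken along an
  enumeration \<open>fs\<close> of \<open>F\<close> without repetitions (the factors commute, so the order is immaterial).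
  The product starts from \<open>e\<close>, the identity of the corner \<open>e K\<^sub>0S e\<close> in which the factors
  live.  For nonempty \<open>F\<close> this changes nothing, and the empty family, which covers only
  \<open>e = 0\<close>, contributes \<open>0\<close> rather than \<open>1\<close>.
\<close>

definition tight_product ::
    "('g, 'm) monoid_scheme \<Rightarrow> ('g \<Rightarrow> 'x list \<Rightarrow> 'x list) \<Rightarrow>
     ('x, 'g) ssg_elem \<Rightarrow> ('x, 'g) ssg_elem list \<Rightarrow> ('x, 'g) ssg_elem \<Rightarrow>\<^sub>0 'k::field" where
  "tight_product G \<phi> e fs =
     foldr (\<lambda>f p. (ssg_scaled 1 e - ssg_scaled 1 f) \<otimes>\<^bsub>contracted_algebra G \<phi>\<^esub> p)
       fs (ssg_scaled 1 e)"

definition tight_ideal ::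
    "('g, 'm) monoid_scheme \<Rightarrow> ('g \<Rightarrow> 'x list \<Rightarrow> 'x list) \<Rightarrow>
     (('x, 'g) ssg_elem \<Rightarrow>\<^sub>0 'k::field) set" where
  "tight_ideal G \<phi> =
     Idl\<^bsub>contracted_algebra G \<phi>\<^esub>
       {tight_product G \<phi> e fs | e fs.
          e \<in> ssg_idem G \<phi> \<and> distinct fs \<and> ssg_covers G \<phi> (set fs) e}"

section \<open>The contracted algebra is a ring\<close>

text \<open>
  \<open>ideal I R\<close>, and hence \<open>Idl\<close>, presupposes that \<open>R\<close> is a ring.  Associativity is
  obtained from the faithful representation of \<open>S\<close> by partial injections on words,
  \<open>u g v\<^sup>*\<close> sending \<open>v w\<close> to \<open>u g(w)\<close>.
\<close>

fun ssg_rep :: "('g \<Rightarrow> 'x list \<Rightarrow> 'x list) \<Rightarrow> ('x, 'g) ssg_elem \<Rightarrow> 'x list \<Rightarrow> 'x list option" where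
  "ssg_rep \<phi> SZero w = None"
| "ssg_rep \<phi> (SEl u g v) w =
     (if prefix v w then Some (u @ \<phi> g (drop (length v) w)) else None)"

context self_similar_group
begin

lemma is_group: "group G"
  using group_hom unfolding group_hom_def by blast

lemma action_mult:
  assumes "g \<in> carrier G" "h \<in> carrier G"
  shows "\<phi> (g \<otimes> h) w = \<phi> g (\<phi> h w)"
  using composition_rule[of w g h] assms by simp

lemma action_one: "\<phi> \<one> w = w"
  using id_eq_one by (metis UNIV_I restrict_apply)

lemma action_inv:
  assumes "g \<in> carrier G"
  shows "\<phi> (inv g) (\<phi> g w) = w" "\<phi> g (\<phi> (inv g) w) = w"
  using assms is_group action_mult action_one
  by (metis group.inv_closed group.l_inv, metis group.inv_closed group.r_inv)

lemma action_eqI: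
  assumes "g \<in> carrier G" "h \<in> carrier G" "\<And>w. \<phi> g w = \<phi> h w"
  shows "g = h"
  using faithful assms by (meson ext inj_onD)

lemma letter_section:
  assumes "g \<in> carrier G"
  shows letter_section_closed: "letter_section G \<phi> g x \<in> carrier G"
    and letter_section_eq: "\<phi> g (x # w) = \<phi> g [x] @ \<phi> (letter_section G \<phi> g x) w"
proof -
  have "\<exists>!h. h \<in> carrier G \<and> (\<forall>w. \<phi> g (x # w) = \<phi> g [x] @ \<phi> h w)"
  proof (rule ex_ex1I)
    show "\<exists>h. h \<in> carrier G \<and> (\<forall>w. \<phi> g (x # w) = \<phi> g [x] @ \<phi> h w)"
      using section_exists[OF assms, of x] by blast
  next
    fix h k
    assume h: "h \<in> carrier G \<and> (\<forall>w. \<phi> g (x # w) = \<phi> g [x] @ \<phi> h w)"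
      and k: "k \<in> carrier G \<and> (\<forall>w. \<phi> g (x # w) = \<phi> g [x] @ \<phi> k w)"
    have "\<phi> h w = \<phi> k w" for w
    proof -
      have "\<phi> g [x] @ \<phi> h w = \<phi> g [x] @ \<phi> k w" using h k by (metis (no_types))
      then show ?thesis by simp
    qed
    then show "h = k" using h k action_eqI by blast
  qed
  from theI'[OF this, folded letter_section_def]
  show "letter_section G \<phi> g x \<in> carrier G"
    and "\<phi> g (x # w) = \<phi> g [x] @ \<phi> (letter_section G \<phi> g x) w" by blast+
qed

lemma word_section_closed: "g \<in> carrier G \<Longrightarrow> word_section G \<phi> g v \<in> carrier G"
  by (induction v arbitrary: g) (auto simp: letter_section_closed)

lemma word_section_eq:
  "g \<in> carrier G \<Longrightarrow> \<phi> g (v @ w) = \<phi> g v @ \<phi> (word_section G \<phi> g v) w"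
proof (induction v arbitrary: g)
  case Nil
  then have "\<phi> g [] = []" using length_preserving by (metis length_0_conv)
  then show ?case by simp
next
  case (Cons x v)
  let ?h = "letter_section G \<phi> g x"
  have h: "?h \<in> carrier G" using Cons.prems by (rule letter_section_closed)
  have "\<phi> g (x # v @ w) = \<phi> g [x] @ \<phi> ?h (v @ w)"
    using Cons.prems by (rule letter_section_eq)
  also have "\<phi> ?h (v @ w) = \<phi> ?h v @ \<phi> (word_section G \<phi> ?h v) w"
    using h by (rule Cons.IH)
  also have "\<phi> g [x] @ \<dots> = \<phi> g (x # v) @ \<phi> (word_section G \<phi> ?h v) w"
    by (subst letter_section_eq[OF Cons.prems, of x v]) simp
  finally show ?case by simp
qed

lemma prefix_action_iff: "g \<in> carrier G \<Longrightarrow> prefix (\<phi> g v) (\<phi> g w) \<longleftrightarrow> prefix v w"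
proof -
  have *: "prefix (\<phi> h v) (\<phi> h w)" if "prefix v w" "h \<in> carrier G" for h v w
    using that word_section_eq by (auto elim!: prefixE)
  assume g: "g \<in> carrier G"
  then have "inv g \<in> carrier G" using is_group by (simp add: group.inv_closed)
  then show ?thesis using *[of "\<phi> g v" "\<phi> g w" "inv g"] *[of v w g] g action_inv by auto
qed

lemma ssg_mult_closed:
  "\<lbrakk>s \<in> ssg_carrier G; t \<in> ssg_carrier G\<rbrakk> \<Longrightarrow> ssg_mult G \<phi> s t \<in> ssg_carrier G"
  by (cases s; cases t)
    (auto simp: ssg_carrier_def Let_def word_section_closed group.is_monoid[OF is_group] monoid.m_closed)

lemma ssg_rep_mult:
  assumes "s \<in> ssg_carrier G" "t \<in> ssg_carrier G"
  shows "ssg_rep \<phi> (ssg_mult G \<phi> s t) y = Option.bind (ssg_rep \<phi> t y) (ssg_rep \<phi> s)"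
proof (cases s)
  case s: (SEl u g v)
  show ?thesis
  proof (cases t)
    case t: (SEl w h z)
    have g: "g \<in> carrier G" and h: "h \<in> carrier G"
      using assms s t by (auto simp: ssg_carrier_def)
    note [simp] = action_mult word_section_closed g h
    consider (1) w' where "w = v @ w'" | (2) v' where "v = w @ v'" "\<not> prefix v w"
      | (3) "\<not> prefix v w" "\<not> prefix w v"
      by (metis prefixE)
    then show ?thesis
    proof cases
      case 1
      then show ?thesis
        by (auto simp: s t word_section_eq)
    next
      case 2
      define q where "q = \<phi> (inv h) v'"
      have hq: "\<phi> h q = v'" by (simp add: q_def action_inv)
      have lq: "length v' = length q" using hq h length_preserving by metis
      have pr: "prefix (z @ q) (z @ y') \<longleftrightarrow> prefix v (w @ \<phi> h y')" for y'
        using prefix_action_iff[OF h, of q y'] by (simp add: 2 hq)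
      have lhs: "ssg_mult G \<phi> s t = SEl u (g \<otimes> word_section G \<phi> h q) (z @ q)"
        using 2 by (simp add: s t q_def Let_def)
      show ?thesis
      proof (cases "prefix z y")
        case True
        then obtain y' where y: "y = z @ y'" by (auto elim: prefixE)
        show ?thesis
        proof (cases "prefix q y'")
          case True
          then obtain y2 where y2: "y' = q @ y2" by (auto elim: prefixE)
          show ?thesis
            unfolding lhs by (simp add: s t y y2 2 word_section_eq hq lq)
        next
          case False
          then show ?thesis unfolding lhs using pr[of y'] by (simp add: s t y)
        qed
      next
        case False
        then have "\<not> prefix (z @ q) y" by (auto dest: append_prefixD)
        then show ?thesis unfolding lhs using False by (simp add: t)
      qed
    next
      case 3
      then have "\<not> prefix v (w @ y')" for y'
        by (metis prefix_append prefix_def prefix_same_cases)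
      then show ?thesis using 3 by (simp add: s t)
    qed
  qed (simp add: s)
qed (cases "ssg_rep \<phi> t y"; simp)

lemma ssg_rep_inj:
  assumes "s \<in> ssg_carrier G" "t \<in> ssg_carrier G" and eq: "ssg_rep \<phi> s = ssg_rep \<phi> t"
  shows "s = t"
proof -
  have nil: "\<phi> g [] = []" if "g \<in> carrier G" for g
    using that length_preserving by (metis length_0_conv)
  have ne: "ssg_rep \<phi> (SEl u g v) \<noteq> ssg_rep \<phi> SZero" for u g v
    by (metis option.distinct(1) prefix_order.refl ssg_rep.simps)
  show ?thesis
  proof (cases s)
    case SZero
    then show ?thesis using eq ne by (cases t) metis+
  next
    case s: (SEl u g v)
    then obtain w h z where t: "t = SEl w h z" using eq ne by (cases t) auto
    have g: "g \<in> carrier G" and h: "h \<in> carrier G"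
      using assms s t by (auto simp: ssg_carrier_def)
    have "prefix v x \<longleftrightarrow> prefix z x" for x
      using fun_cong[OF eq, of x] by (auto simp: s t split: if_splits)
    then have vz: "v = z" by (meson prefix_order.antisym prefix_order.refl)
    have act: "u @ \<phi> g x = w @ \<phi> h x" for x
      using fun_cong[OF eq, of "v @ x"] by (simp add: s t vz)
    have "u = w" using act[of "[]"] g h nil by simp
    then show ?thesis using act action_eqI[OF g h] by (simp add: s t vz)
  qed
qed

lemma ssg_mult_assoc:
  assumes "r \<in> ssg_carrier G" "s \<in> ssg_carrier G" "t \<in> ssg_carrier G"
  shows "ssg_mult G \<phi> (ssg_mult G \<phi> r s) t = ssg_mult G \<phi> r (ssg_mult G \<phi> s t)"
proof (rule ssg_rep_inj)
  show "ssg_rep \<phi> (ssg_mult G \<phi> (ssg_mult G \<phi> r s) t) = ssg_rep \<phi> (ssg_mult G \<phi> r (ssg_mult G \<phi> s t))"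
  proof
    fix y
    have "(\<lambda>z. Option.bind (ssg_rep \<phi> s z) (ssg_rep \<phi> r)) = ssg_rep \<phi> (ssg_mult G \<phi> r s)"
      using assms by (simp add: ssg_rep_mult fun_eq_iff)
    then show "ssg_rep \<phi> (ssg_mult G \<phi> (ssg_mult G \<phi> r s) t) y = ssg_rep \<phi> (ssg_mult G \<phi> r (ssg_mult G \<phi> s t)) y"
      using assms by (simp add: ssg_rep_mult ssg_mult_closed)
  qed
qed (use assms ssg_mult_closed in auto)

end

abbreviation (input) cmul ::
    "('g, 'm) monoid_scheme \<Rightarrow> ('g \<Rightarrow> 'x list \<Rightarrow> 'x list) \<Rightarrow> (('x, 'g) ssg_elem \<Rightarrow>\<^sub>0 'k::field) \<Rightarrow>
     (('x, 'g) ssg_elem \<Rightarrow>\<^sub>0 'k) \<Rightarrow> ('x, 'g) ssg_elem \<Rightarrow>\<^sub>0 'k" where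
  "cmul G \<phi> \<equiv> monoid.mult (contracted_algebra G \<phi>)"

lemma ssg_scaled_add: "ssg_scaled (c + d) s = ssg_scaled c s + ssg_scaled d s"
  by (simp add: ssg_scaled_def single_add)

lemma ssg_scaled_0 [simp]: "ssg_scaled 0 s = 0" "ssg_scaled c SZero = 0"
  by (simp_all add: ssg_scaled_def)

lemma contracted_mult_superset:
  assumes "finite A" "finite B" "Poly_Mapping.keys a \<subseteq> A" "Poly_Mapping.keys b \<subseteq> B"
  shows "cmul G \<phi> a b = (\<Sum>s\<in>A. \<Sum>t\<in>B.
     ssg_scaled (Poly_Mapping.lookup a s * Poly_Mapping.lookup b t) (ssg_mult G \<phi> s t))"
proof -
  have "cmul G \<phi> a b = (\<Sum>s\<in>Poly_Mapping.keys a. \<Sum>t\<in>B.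
     ssg_scaled (Poly_Mapping.lookup a s * Poly_Mapping.lookup b t) (ssg_mult G \<phi> s t))"
    unfolding contracted_algebra_def
    using assms by (auto intro!: sum.cong[OF refl] sum.mono_neutral_left simp: not_in_keys_iff_lookup_eq_zero)
  also have "\<dots> = (\<Sum>s\<in>A. \<Sum>t\<in>B.
     ssg_scaled (Poly_Mapping.lookup a s * Poly_Mapping.lookup b t) (ssg_mult G \<phi> s t))"
    using assms by (intro sum.mono_neutral_left) (auto simp: in_keys_iff)
  finally show ?thesis .
qed

lemma contracted_mult_add:
  "cmul G \<phi> (a + b) c = cmul G \<phi> a c + cmul G \<phi> b c"
  "cmul G \<phi> c (a + b) = cmul G \<phi> c a + cmul G \<phi> c b"
proof -
  let ?A = "Poly_Mapping.keys a \<union> Poly_Mapping.keys b"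
  let ?C = "Poly_Mapping.keys c"
  have k: "finite ?A" "finite ?C" "Poly_Mapping.keys a \<subseteq> ?A" "Poly_Mapping.keys b \<subseteq> ?A"
    "Poly_Mapping.keys (a + b) \<subseteq> ?A" "?C \<subseteq> ?C"
    using keys_add[of a b] by auto
  note m = contracted_mult_superset[where A = ?A and B = ?C]
    contracted_mult_superset[where A = ?C and B = ?A]
  show "cmul G \<phi> (a + b) c = cmul G \<phi> a c + cmul G \<phi> b c"
    "cmul G \<phi> c (a + b) = cmul G \<phi> c a + cmul G \<phi> c b"
    using k by (simp_all add: m lookup_add distrib_right distrib_left ssg_scaled_add sum.distrib)
qed

lemma contracted_mult_zero: "cmul G \<phi> 0 c = 0" "cmul G \<phi> c 0 = 0"
  by (simp_all add: contracted_algebra_def)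

lemma contracted_mult_sum:
  "cmul G \<phi> (sum f A) c = (\<Sum>x\<in>A. cmul G \<phi> (f x) c)"
  "cmul G \<phi> c (sum f A) = (\<Sum>x\<in>A. cmul G \<phi> c (f x))"
  by (induction A rule: infinite_finite_induct) (auto simp: contracted_mult_add contracted_mult_zero)

lemma ssg_mult_SZero [simp]: "ssg_mult G \<phi> s SZero = SZero"
  by (cases s) simp_all

lemma contracted_mult_scaled:
  "cmul G \<phi> (ssg_scaled c s) (ssg_scaled d t) = ssg_scaled (c * d) (ssg_mult G \<phi> s t)"
proof (cases "s = SZero \<or> t = SZero")
  case True
  then show ?thesis by (auto simp: contracted_mult_zero)
next
  case False
  then show ?thesis
    by (subst contracted_mult_superset[where A = "{s}" and B = "{t}"])
      (auto simp: ssg_scaled_def)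
qed

lemma contracted_expand:
  assumes "SZero \<notin> Poly_Mapping.keys a"
  shows "a = (\<Sum>s\<in>Poly_Mapping.keys a. ssg_scaled (Poly_Mapping.lookup a s) s)"
proof -
  have "a = (\<Sum>s\<in>Poly_Mapping.keys a. Poly_Mapping.single s (Poly_Mapping.lookup a s))"
    by (intro poly_mapping_eqI)
      (simp add: lookup_sum lookup_single when_def in_keys_iff)
  also have "\<dots> = (\<Sum>s\<in>Poly_Mapping.keys a. ssg_scaled (Poly_Mapping.lookup a s) s)"
    using assms by (intro sum.cong) (auto simp: ssg_scaled_def)
  finally show ?thesis .
qed

context self_similar_group
begin

lemma ssg_scaled_closed:
  "s \<in> ssg_carrier G \<Longrightarrow> ssg_scaled c s \<in> carrier (contracted_algebra G \<phi>)"
  by (auto simp: ssg_scaled_def contracted_algebra_def)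

lemma contracted_mult_closed:
  fixes a b :: "('x, 'g) ssg_elem \<Rightarrow>\<^sub>0 'k::field"
  assumes "a \<in> carrier (contracted_algebra G \<phi>)" "b \<in> carrier (contracted_algebra G \<phi>)"
  shows "cmul G \<phi> a b \<in> carrier (contracted_algebra G \<phi>)"
proof -
  let ?C = "carrier (contracted_algebra G \<phi>) :: (('x, 'g) ssg_elem \<Rightarrow>\<^sub>0 'k) set"
  have sum_closed: "sum f A \<in> ?C" if "\<And>x. x \<in> A \<Longrightarrow> f x \<in> ?C"
    for f :: "('x, 'g) ssg_elem \<Rightarrow> ('x, 'g) ssg_elem \<Rightarrow>\<^sub>0 'k" and A
    using that keys_sum[of f A] by (fastforce simp: contracted_algebra_def)
  have "cmul G \<phi> a b = (\<Sum>s\<in>Poly_Mapping.keys a. \<Sum>t\<in>Poly_Mapping.keys b.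
      ssg_scaled (Poly_Mapping.lookup a s * Poly_Mapping.lookup b t) (ssg_mult G \<phi> s t))"
    by (simp add: contracted_algebra_def)
  also have "\<dots> \<in> ?C"
    using assms by (intro sum_closed ssg_scaled_closed ssg_mult_closed)
      (auto simp: contracted_algebra_def)
  finally show ?thesis .
qed

lemma contracted_mult_assoc:
  assumes "a \<in> carrier (contracted_algebra G \<phi>)" "b \<in> carrier (contracted_algebra G \<phi>)"
    "c \<in> carrier (contracted_algebra G \<phi>)"
  shows "cmul G \<phi> (cmul G \<phi> a b) c = cmul G \<phi> a (cmul G \<phi> b c)"
proof -
  let ?l = Poly_Mapping.lookup and ?k = Poly_Mapping.keys
  have k: "?k a \<subseteq> ssg_carrier G" "?k b \<subseteq> ssg_carrier G" "?k c \<subseteq> ssg_carrier G"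
    and e: "SZero \<notin> ?k a" "SZero \<notin> ?k b" "SZero \<notin> ?k c"
    using assms by (auto simp: contracted_algebra_def)
  define a' b' c' where
    "a' = (\<Sum>s\<in>?k a. ssg_scaled (?l a s) s)" and
    "b' = (\<Sum>s\<in>?k b. ssg_scaled (?l b s) s)" and
    "c' = (\<Sum>s\<in>?k c. ssg_scaled (?l c s) s)"
  have "cmul G \<phi> (cmul G \<phi> a' b') c' = cmul G \<phi> a' (cmul G \<phi> b' c')"
    unfolding a'_def b'_def c'_def contracted_mult_sum contracted_mult_scaled
    using k by (intro sum.cong refl) (simp add: subset_iff ssg_mult_assoc mult.assoc)
  then show ?thesis
    using e[THEN contracted_expand] by (simp add: a'_def b'_def c'_def)
qed

lemma contracted_one:
  assumes "a \<in> carrier (contracted_algebra G \<phi>)"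
  shows "cmul G \<phi> (ssg_scaled 1 (SEl [] \<one> [])) a = a"
    "cmul G \<phi> a (ssg_scaled 1 (SEl [] \<one> [])) = a"
proof -
  let ?l = Poly_Mapping.lookup and ?k = Poly_Mapping.keys and ?e = "SEl [] \<one> [] :: ('x, 'g) ssg_elem"
  have k: "?k a \<subseteq> ssg_carrier G" and e: "SZero \<notin> ?k a"
    using assms by (auto simp: contracted_algebra_def)
  have ec: "?e \<in> ssg_carrier G"
    using group.is_monoid[OF is_group] by (simp add: ssg_carrier_def monoid.one_closed)
  have rep: "ssg_rep \<phi> ?e = Some" by (simp add: fun_eq_iff action_one)
  have unit: "ssg_mult G \<phi> ?e s = s" "ssg_mult G \<phi> s ?e = s" if "s \<in> ssg_carrier G" for s
    using that ec by (auto intro!: ssg_rep_inj ssg_mult_closed ext simp: ssg_rep_mult rep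
        simp del: ssg_rep.simps)
  define a' where "a' = (\<Sum>s\<in>?k a. ssg_scaled (?l a s) s)"
  have a: "a = a'" unfolding a'_def by (rule contracted_expand[OF e])
  have "cmul G \<phi> (ssg_scaled 1 ?e) a' = a'" "cmul G \<phi> a' (ssg_scaled 1 ?e) = a'"
    unfolding a'_def contracted_mult_sum contracted_mult_scaled
    using k unit by (auto intro!: sum.cong)
  then show "cmul G \<phi> (ssg_scaled 1 ?e) a = a" "cmul G \<phi> a (ssg_scaled 1 ?e) = a"
    by (simp_all add: a)
qed

theorem contracted_algebra_ring:
  "ring (contracted_algebra G \<phi> :: (('x, 'g) ssg_elem \<Rightarrow>\<^sub>0 'k::field) ring)" (is "ring ?R")
proof -
  have sel: "ring.add ?R = (+)" "ring.zero ?R = 0" "monoid.one ?R = ssg_scaled 1 (SEl [] \<one> [])"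
    "carrier ?R = {a. Poly_Mapping.keys a \<subseteq> ssg_carrier G - {SZero}}"
    by (simp_all add: contracted_algebra_def)
  have onec: "monoid.one ?R \<in> carrier ?R"
    unfolding sel(3) using group.is_monoid[OF is_group]
    by (intro ssg_scaled_closed) (simp add: ssg_carrier_def monoid.one_closed)
  have "abelian_group ?R"
  proof (rule abelian_groupI)
    fix a b assume "a \<in> carrier ?R" "b \<in> carrier ?R"
    then show "a \<oplus>\<^bsub>?R\<^esub> b \<in> carrier ?R"
      unfolding sel using keys_add[of a b] by blast
  next
    fix a assume "a \<in> carrier ?R"
    then show "\<exists>b\<in>carrier ?R. b \<oplus>\<^bsub>?R\<^esub> a = \<zero>\<^bsub>?R\<^esub>"
      unfolding sel by (intro bexI[of _ "- a"]) auto
  qed (auto simp: sel ac_simps)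
  moreover have "Group.monoid ?R"
    by (rule monoidI)
      (use onec contracted_mult_closed contracted_mult_assoc contracted_one in \<open>auto simp: sel(3)\<close>)
  ultimately show ?thesis
    by (rule ringI) (simp_all add: sel(1) contracted_mult_add)
qed

end

end

theory Submission
  imports Defs
begin

text \<open>
  Modulo the tight ideal \<open>T\<close> the identity is the sum of the projections \<open>w w\<^sup>*\<close> over all words \<open>w\<close> of
  any fixed length \<open>n\<close>, because these projections are pairwise orthogonal and cover \<open>1\<close>
  (\<open>tight_complement_of_level\<close>).  Hence if \<open>a\<close> is outside \<open>T\<close>, so is \<open>a w\<close> for some \<open>w\<close> of length
  \<open>n\<close>.  Taking \<open>n\<close> at least as large as the length of every \<open>v\<close> that occurs in a term \<open>u g v\<^sup>*\<close> of
  \<open>a\<close>, right multiplication by \<open>w\<close> removes all the starred words, so that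
  \<open>a w = \<Sum>\<^sub>u u b\<^sub>u\<close> with \<open>b\<^sub>u\<close> in the group algebra.  Since \<open>T\<close> is a left ideal, some \<open>b\<^sub>u\<close> lies
  outside \<open>T\<close>.

  Every \<open>b\<^sub>u\<close> is singular if \<open>a\<close> is.  Singularity passes from \<open>a\<close> to \<open>a w\<close> because
  \<open>w y y\<^sup>* = (w y)(w y)\<^sup>* w\<close>.  It passes from \<open>a w\<close> to each \<open>b\<^sub>u\<close> because the elements
  \<open>u b\<^sub>u y y\<^sup>*\<close> have disjoint supports: their terms are \<open>u g(y) g|\<^sub>y y\<^sup>*\<close>, and \<open>g(y)\<close> has the
  length of \<open>y\<close>, so \<open>u\<close> can be read off from the term.  Thus an idempotent \<open>y y\<^sup>*\<close> that annihilates
  \<open>a w\<close> annihilates every \<open>b\<^sub>u\<close>.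
\<close>

section \<open>Sums in the contracted algebra and its ideals\<close>

lemma contracted_mult_diff:
  "cmul G \<phi> (a - b) c = cmul G \<phi> a c - cmul G \<phi> b c"
  "cmul G \<phi> c (a - b) = cmul G \<phi> c a - cmul G \<phi> c b"
  using contracted_mult_add(1)[of G \<phi> "a - b" b c] contracted_mult_add(2)[of G \<phi> c "a - b" b]
  by simp_all

lemma contracted_mult_scaled_right:
  "cmul G \<phi> a (ssg_scaled c t) =
    (\<Sum>s\<in>Poly_Mapping.keys a. ssg_scaled (Poly_Mapping.lookup a s * c) (ssg_mult G \<phi> s t))"
  by (subst contracted_mult_superset[where A = "Poly_Mapping.keys a" and B = "{t}"])
    (auto simp: ssg_scaled_def lookup_single cong: if_cong)

lemma ideal_add_closed:
  fixes a b :: "('x, 'g) ssg_elem \<Rightarrow>\<^sub>0 'k::field"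
  assumes "ideal J (contracted_algebra G \<phi>)" "a \<in> J" "b \<in> J"
  shows "a + b \<in> J"
  using additive_subgroup.a_closed[OF ideal.axioms(1)[OF assms(1)] assms(2,3)]
  by (simp add: contracted_algebra_def)

lemma ideal_sum_closed:
  fixes f :: "'a \<Rightarrow> ('x, 'g) ssg_elem \<Rightarrow>\<^sub>0 'k::field"
  assumes J: "ideal J (contracted_algebra G \<phi>)" and f: "\<And>x. x \<in> A \<Longrightarrow> f x \<in> J"
  shows "sum f A \<in> J"
proof -
  have "0 \<in> J"
    using additive_subgroup.zero_closed[OF ideal.axioms(1)[OF J]]
    by (simp add: contracted_algebra_def)
  with f show ?thesis
    by (induction A rule: infinite_finite_induct) (auto intro: ideal_add_closed[OF J])
qed

lemma contracted_sum_closed: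
  fixes f :: "'a \<Rightarrow> ('x, 'g) ssg_elem \<Rightarrow>\<^sub>0 'k::field"
  assumes "\<And>x. x \<in> A \<Longrightarrow> f x \<in> carrier (contracted_algebra G \<phi>)"
  shows "sum f A \<in> carrier (contracted_algebra G \<phi>)"
  using assms keys_sum[of f A] by (fastforce simp: contracted_algebra_def)

context self_similar_group
begin

section \<open>Words and projections in the inverse semigroup\<close>

lemma one_in_carrier: "\<one> \<in> carrier G"
  using is_group by (simp add: group.is_monoid monoid.one_closed)

lemma mult_one: "g \<in> carrier G \<Longrightarrow> \<one> \<otimes> g = g" "g \<in> carrier G \<Longrightarrow> g \<otimes> \<one> = g"
  using is_group by (simp_all add: group.is_monoid monoid.l_one monoid.r_one)

lemma action_Nil: "g \<in> carrier G \<Longrightarrow> \<phi> g [] = []"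
  using length_preserving by (metis length_0_conv)

lemma word_section_one: "word_section G \<phi> \<one> v = \<one>"
proof (rule action_eqI)
  fix w
  show "\<phi> (word_section G \<phi> \<one> v) w = \<phi> \<one> w"
    using word_section_eq[OF one_in_carrier, of v w] by (simp add: action_one)
qed (simp_all add: one_in_carrier word_section_closed)

lemma inv_one: "inv \<one> = \<one>"
  using is_group by (simp add: group.is_monoid monoid.inv_one)

lemmas unit_simps = action_one action_Nil word_section_one inv_one one_in_carrier mult_one
  word_section_closed

abbreviation word_elem :: "'x list \<Rightarrow> ('x, 'g) ssg_elem" where
  "word_elem w \<equiv> SEl w \<one> []"

abbreviation projection :: "'x list \<Rightarrow> ('x, 'g) ssg_elem" where
  "projection w \<equiv> SEl w \<one> w"

lemma SEl_in_carrier [simp]: "SEl u g v \<in> ssg_carrier G \<longleftrightarrow> g \<in> carrier G"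
  by (auto simp: ssg_carrier_def)

lemma projection_idem: "projection w \<in> ssg_idem G \<phi>"
  by (simp add: ssg_idem_def unit_simps)

lemma nonzero_idem_is_projection:
  assumes "e \<in> ssg_idem G \<phi>" "e \<noteq> SZero"
  obtains p where "e = projection p"
proof -
  obtain u g v where e: "e = SEl u g v" using assms(2) by (cases e) auto
  have g: "g \<in> carrier G" and idem: "ssg_mult G \<phi> (SEl u g v) (SEl u g v) = SEl u g v"
    using assms by (auto simp: ssg_idem_def e)
  have nil: "w = []" if "\<phi> h w = []" "h \<in> carrier G" for h w
    using length_preserving[OF that(2), of w] that(1) by simp
  show ?thesis
  proof (cases "prefix v u")
    case True
    then obtain w where w: "u = v @ w" by (auto elim: prefixE)
    have "w = []" using idem g nil by (auto simp: w)
    then have "u = v" "g \<otimes> g = g" using idem w by auto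
    moreover have "g = \<one>" using \<open>g \<otimes> g = g\<close> g group.l_cancel_one'[OF is_group] by metis
    ultimately show ?thesis using that e by simp
  next
    case False
    then obtain w where w: "v = u @ w" using idem by (auto elim: prefixE split: if_splits)
    have "w = []"
      using idem False g nil[of "inv g" w] group.inv_closed[OF is_group] by (auto simp: w Let_def)
    then show ?thesis using False w by simp
  qed
qed

lemma projection_le_iff: "ssg_le G \<phi> (projection p) (projection y) \<longleftrightarrow> prefix y p"
  by (auto simp: ssg_le_def unit_simps Let_def elim!: prefixE)

lemma projection_orthogonal:
  "\<lbrakk>length v = length w; v \<noteq> w\<rbrakk> \<Longrightarrow> ssg_mult G \<phi> (projection v) (projection w) = SZero"
  by (auto elim!: prefixE)

lemma word_mult_projection:
  "ssg_mult G \<phi> (word_elem w) (projection y) =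
   ssg_mult G \<phi> (projection (w @ y)) (word_elem w)"
  by (cases "y = []") (auto simp: unit_simps Let_def prefix_def)

text \<open>
  The nonzero idempotents below \<open>y y\<^sup>*\<close> are the \<open>(y x)(y x)\<^sup>*\<close>, so the singular ideal can be
  described by words alone.
\<close>

lemma singular_ideal_iff:
  fixes a :: "('x, 'g) ssg_elem \<Rightarrow>\<^sub>0 'k::field"
  shows "a \<in> singular_ideal G \<phi> \<longleftrightarrow> a \<in> carrier (contracted_algebra G \<phi>) \<and>
    (\<forall>y. \<exists>x. cmul G \<phi> a (ssg_scaled 1 (projection (y @ x))) = 0)"
    (is "_ \<longleftrightarrow> ?C \<and> ?D")
proof -
  have z: "\<zero>\<^bsub>contracted_algebra G \<phi>\<^esub> = (0 :: ('x, 'g) ssg_elem \<Rightarrow>\<^sub>0 'k)"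
    by (simp add: contracted_algebra_def)
  have "?D" if a: "a \<in> singular_ideal G \<phi>"
  proof
    fix y
    obtain f where f: "f \<in> ssg_idem G \<phi>" "f \<noteq> SZero" "ssg_le G \<phi> f (projection y)"
      "cmul G \<phi> a (ssg_scaled 1 f) = 0"
      using a projection_idem[of y] unfolding singular_ideal_def z by blast
    obtain p where p: "f = projection p" using nonzero_idem_is_projection f by blast
    then obtain x where "p = y @ x" using f projection_le_iff by (auto elim: prefixE)
    then show "\<exists>x. cmul G \<phi> a (ssg_scaled 1 (projection (y @ x))) = 0" using f p by blast
  qed
  moreover have "a \<in> singular_ideal G \<phi>" if C: "?C" and D: "?D"
    unfolding singular_ideal_def z
  proof (intro CollectI conjI ballI impI)
    fix e assume "e \<in> ssg_idem G \<phi>" "e \<noteq> SZero"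
    then obtain y where y: "e = projection y" by (rule nonzero_idem_is_projection)
    obtain x where "cmul G \<phi> a (ssg_scaled 1 (projection (y @ x))) = 0" using D by blast
    then show "\<exists>f\<in>ssg_idem G \<phi>. f \<noteq> SZero \<and> ssg_le G \<phi> f e \<and> cmul G \<phi> a (ssg_scaled 1 f) = 0"
      using projection_idem projection_le_iff y
      by (intro bexI[of _ "projection (y @ x)"]) (auto simp del: ssg_mult.simps)
  qed (use C in simp)
  ultimately show ?thesis by (auto simp: singular_ideal_def)
qed

section \<open>The tight ideal\<close>

lemma tight_product_closed:
  assumes "e \<in> ssg_carrier G" "set fs \<subseteq> ssg_carrier G"
  shows "(tight_product G \<phi> e fs :: ('x, 'g) ssg_elem \<Rightarrow>\<^sub>0 'k::field)
    \<in> carrier (contracted_algebra G \<phi>)"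
proof -
  have diff: "a - b \<in> carrier (contracted_algebra G \<phi>)"
    if "a \<in> carrier (contracted_algebra G \<phi>)" "b \<in> carrier (contracted_algebra G \<phi>)"
    for a b :: "('x, 'g) ssg_elem \<Rightarrow>\<^sub>0 'k"
    using that keys_diff[of a b] by (auto simp: contracted_algebra_def)
  from assms(2) show ?thesis
    by (induction fs)
      (auto simp: tight_product_def assms(1) intro!: contracted_mult_closed diff ssg_scaled_closed)
qed

lemma tight_generators_closed:
  "{tight_product G \<phi> e fs | e fs.
      e \<in> ssg_idem G \<phi> \<and> distinct fs \<and> ssg_covers G \<phi> (set fs) e}
   \<subseteq> (carrier (contracted_algebra G \<phi>) :: (('x, 'g) ssg_elem \<Rightarrow>\<^sub>0 'k::field) set)"
  by (auto simp: ssg_covers_def ssg_idem_def intro!: tight_product_closed)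

lemma tight_ideal_is_ideal:
  "ideal (tight_ideal G \<phi>) (contracted_algebra G \<phi> :: (('x, 'g) ssg_elem \<Rightarrow>\<^sub>0 'k::field) ring)"
  unfolding tight_ideal_def
  by (rule ring.genideal_ideal[OF contracted_algebra_ring tight_generators_closed])

lemma tight_product_orthogonal_projections:
  assumes "distinct ws" "\<And>w. w \<in> set ws \<Longrightarrow> length w = n"
  shows "(tight_product G \<phi> (projection []) (map projection ws)
      :: ('x, 'g) ssg_elem \<Rightarrow>\<^sub>0 'k::field) =
    ssg_scaled 1 (projection []) - (\<Sum>w\<in>set ws. ssg_scaled 1 (projection w))"
  using assms
proof (induction ws)
  case Nil
  then show ?case by (simp add: tight_product_def)
next
  case (Cons v ws)
  let ?p = "\<lambda>w. ssg_scaled 1 (projection w) :: ('x, 'g) ssg_elem \<Rightarrow>\<^sub>0 'k"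
  have carr: "?p w \<in> carrier (contracted_algebra G \<phi>)" for w
    by (simp add: ssg_scaled_closed one_in_carrier)
  have orth: "cmul G \<phi> (?p v) (\<Sum>w\<in>set ws. ?p w) = 0"
    unfolding contracted_mult_sum contracted_mult_scaled
  proof (rule sum.neutral, rule ballI)
    fix w assume "w \<in> set ws"
    then have "ssg_mult G \<phi> (projection v) (projection w) = SZero"
      using Cons.prems by (intro projection_orthogonal) auto
    then show "ssg_scaled (1 * 1) (ssg_mult G \<phi> (projection v) (projection w)) = (0 :: _ \<Rightarrow>\<^sub>0 'k)"
      by simp
  qed
  have "tight_product G \<phi> (projection []) (map projection (v # ws)) =
    cmul G \<phi> (?p [] - ?p v) (?p [] - (\<Sum>w\<in>set ws. ?p w))"
    using Cons by (simp add: tight_product_def)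
  also have "\<dots> = ?p [] - (\<Sum>w\<in>set ws. ?p w) - ?p v"
    by (simp only: contracted_mult_diff orth contracted_one carr
        contracted_sum_closed[where f = ?p]) simp
  finally show ?case using Cons.prems by (simp add: algebra_simps)
qed

lemma projections_of_level_cover:
  "ssg_covers G \<phi> (projection ` {w. length w = n}) (projection [])"
  unfolding ssg_covers_def
proof (intro conjI ballI impI)
  fix e assume "e \<noteq> (SZero :: ('x, 'g) ssg_elem)"
  then obtain u g v where e: "e = SEl u g v" by (cases e) auto
  \<comment> \<open>Truncate \<open>v\<close>, or pad it with an arbitrary letter, to reach length \<open>n\<close>.\<close>
  let ?w = "take n v @ replicate (n - length v) undefined"
  have "prefix v ?w \<or> prefix ?w v" by (cases "n \<le> length v") (simp_all add: take_is_prefix)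
  then have "ssg_mult G \<phi> e (projection ?w) \<noteq> SZero" by (auto simp: e Let_def)
  moreover have "length ?w = n" by simp
  ultimately show "\<exists>f\<in>projection ` {w. length w = n}. ssg_mult G \<phi> e f \<noteq> SZero" by blast
qed (auto simp: projection_idem projection_le_iff)

text \<open>
  Expanding the product of the \<open>1 - w w\<^sup>*\<close> leaves only the linear terms because the projections are
  orthogonal.
\<close>

lemma tight_complement_of_level:
  "ssg_scaled 1 (projection []) - (\<Sum>w\<in>{w. length w = n}. ssg_scaled 1 (projection w))
    \<in> (tight_ideal G \<phi> :: (('x, 'g) ssg_elem \<Rightarrow>\<^sub>0 'k::field) set)"
proof -
  have "finite {w :: 'x list. length w = n}"
    using finite_lists_length_eq[of "UNIV :: 'x set" n] by simp
  then obtain ws where ws: "set ws = {w :: 'x list. length w = n}" "distinct ws"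
    using finite_distinct_list by blast
  have "distinct (map projection ws)" using ws by (auto simp: distinct_map inj_on_def)
  moreover have "ssg_covers G \<phi> (set (map projection ws)) (projection [])"
    using projections_of_level_cover[of n] ws by simp
  ultimately have "tight_product G \<phi> (projection []) (map projection ws)
      \<in> (tight_ideal G \<phi> :: (('x, 'g) ssg_elem \<Rightarrow>\<^sub>0 'k) set)"
    unfolding tight_ideal_def using projection_idem
    by (intro subsetD[OF ring.genideal_self[OF contracted_algebra_ring tight_generators_closed]])
      blast
  then show ?thesis
    using tight_product_orthogonal_projections[of ws n, where ?'k = 'k] ws by simp
qed

text \<open>
  If all the \<open>a w\<close> were in the tight ideal, then so would be \<open>\<Sum>\<^sub>w a w w\<^sup>*\<close>, which is congruent to \<open>a\<close>.
\<close>

lemma not_tight_mult_word: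
  fixes a :: "('x, 'g) ssg_elem \<Rightarrow>\<^sub>0 'k::field"
  assumes a: "a \<in> carrier (contracted_algebra G \<phi>)" "a \<notin> tight_ideal G \<phi>"
  obtains w where "length w = n" "cmul G \<phi> a (ssg_scaled 1 (word_elem w)) \<notin> tight_ideal G \<phi>"
proof -
  interpret T: ideal "tight_ideal G \<phi>" "contracted_algebra G \<phi> :: (('x, 'g) ssg_elem \<Rightarrow>\<^sub>0 'k) ring"
    by (rule tight_ideal_is_ideal)
  let ?d = "\<lambda>s. ssg_scaled 1 s :: ('x, 'g) ssg_elem \<Rightarrow>\<^sub>0 'k"
  let ?L = "{w :: 'x list. length w = n}"
  have False
    if tight: "\<And>w. length w = n \<Longrightarrow> cmul G \<phi> a (?d (word_elem w)) \<in> tight_ideal G \<phi>"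
  proof -
    let ?c = "?d (projection []) - (\<Sum>w\<in>?L. ?d (projection w))"
    have carr: "?d (SEl u \<one> v) \<in> carrier (contracted_algebra G \<phi>)" for u v
      by (simp add: ssg_scaled_closed one_in_carrier)
    have "cmul G \<phi> a (?d (projection w)) \<in> tight_ideal G \<phi>" if "w \<in> ?L" for w
    proof -
      have "?d (projection w) = cmul G \<phi> (?d (word_elem w)) (?d (SEl [] \<one> w))"
        by (simp add: contracted_mult_scaled unit_simps)
      then have "cmul G \<phi> a (?d (projection w))
          = cmul G \<phi> (cmul G \<phi> a (?d (word_elem w))) (?d (SEl [] \<one> w))"
        using a carr by (simp add: contracted_mult_assoc)
      then show ?thesis using tight that carr T.I_r_closed by simp
    qed
    then have "cmul G \<phi> a (\<Sum>w\<in>?L. ?d (projection w)) \<in> tight_ideal G \<phi>"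
      unfolding contracted_mult_sum by (rule ideal_sum_closed[OF tight_ideal_is_ideal])
    moreover have "cmul G \<phi> a ?c \<in> tight_ideal G \<phi>"
      using tight_complement_of_level a T.I_l_closed by blast
    ultimately have "cmul G \<phi> a ?c + cmul G \<phi> a (\<Sum>w\<in>?L. ?d (projection w)) \<in> tight_ideal G \<phi>"
      by (rule ideal_add_closed[OF tight_ideal_is_ideal, rotated])
    then have "cmul G \<phi> a (?d (projection [])) \<in> tight_ideal G \<phi>"
      by (simp add: contracted_mult_diff)
    then show False using a by (simp add: contracted_one)
  qed
  then show ?thesis using that by blast
qed

section \<open>Removing the starred words\<close>

text \<open>
  An idempotent below \<open>(w y)(w y)\<^sup>*\<close> that annihilates \<open>a\<close> has the form \<open>(w y x)(w y x)\<^sup>*\<close>; moving \<open>w\<close>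
  across it shows that \<open>(y x)(y x)\<^sup>*\<close> annihilates \<open>a w\<close>.
\<close>

lemma singular_mult_word:
  fixes a :: "('x, 'g) ssg_elem \<Rightarrow>\<^sub>0 'k::field"
  assumes "a \<in> singular_ideal G \<phi>"
  shows "cmul G \<phi> a (ssg_scaled 1 (word_elem w)) \<in> singular_ideal G \<phi>"
proof -
  let ?d = "\<lambda>s. ssg_scaled 1 s :: ('x, 'g) ssg_elem \<Rightarrow>\<^sub>0 'k"
  have carr: "?d (SEl u \<one> v) \<in> carrier (contracted_algebra G \<phi>)" for u v
    by (simp add: ssg_scaled_closed one_in_carrier)
  have a: "a \<in> carrier (contracted_algebra G \<phi>)" using assms by (simp add: singular_ideal_iff)
  have "\<exists>x. cmul G \<phi> (cmul G \<phi> a (?d (word_elem w))) (?d (projection (y @ x))) = 0" for y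
  proof -
    obtain x where x: "cmul G \<phi> a (?d (projection ((w @ y) @ x))) = 0"
      using assms unfolding singular_ideal_iff by blast
    have "cmul G \<phi> (cmul G \<phi> a (?d (word_elem w))) (?d (projection (y @ x)))
        = cmul G \<phi> a (cmul G \<phi> (?d (word_elem w)) (?d (projection (y @ x))))"
      using a carr by (simp add: contracted_mult_assoc)
    also have "\<dots> = cmul G \<phi> (cmul G \<phi> a (?d (projection (w @ y @ x)))) (?d (word_elem w))"
      using a carr
      by (simp add: contracted_mult_assoc contracted_mult_scaled word_mult_projection
          del: ssg_mult.simps)
    also have "\<dots> = 0" using x by (simp add: contracted_mult_zero)
    finally show ?thesis by blast
  qed
  then show ?thesis using a carr by (simp add: singular_ideal_iff contracted_mult_closed)
qed

text \<open>
  A term \<open>u g v\<^sup>*\<close> with \<open>v\<close> no longer than \<open>w\<close> is killed by \<open>w\<close> unless \<open>w = v w'\<close>, and then the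
  product is \<open>u g(w') g|\<^sub>w\<^sub>'\<close>, without a starred word.
\<close>

lemma keys_mult_long_word:
  fixes a :: "('x, 'g) ssg_elem \<Rightarrow>\<^sub>0 'k::field"
  assumes a: "a \<in> carrier (contracted_algebra G \<phi>)"
    and long: "\<And>u g v. SEl u g v \<in> Poly_Mapping.keys a \<Longrightarrow> length v \<le> length w"
  shows "Poly_Mapping.keys (cmul G \<phi> a (ssg_scaled 1 (word_elem w)))
    \<subseteq> {SEl u g [] | u g. g \<in> carrier G}"
proof -
  let ?l = Poly_Mapping.lookup and ?k = Poly_Mapping.keys
  have "ssg_mult G \<phi> s (word_elem w) \<in> insert SZero {SEl u g [] | u g. g \<in> carrier G}"
    if s: "s \<in> ?k a" for s
  proof (cases s)
    case t: (SEl u g v)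
    have "g \<in> carrier G" using s a t by (auto simp: contracted_algebra_def)
    moreover have "length v \<le> length w" using long s t by blast
    ultimately show ?thesis by (auto simp: t unit_simps elim!: prefixE)
  qed simp
  moreover have "cmul G \<phi> a (ssg_scaled 1 (word_elem w))
      = (\<Sum>s\<in>?k a. ssg_scaled (?l a s) (ssg_mult G \<phi> s (word_elem w)))"
    by (simp only: contracted_mult_scaled_right mult_1_right)
  ultimately show ?thesis
    using keys_sum[of "\<lambda>s. ssg_scaled (?l a s) (ssg_mult G \<phi> s (word_elem w))" "?k a"]
    by (fastforce simp: ssg_scaled_def split: if_splits)
qed

section \<open>Group algebra coefficients\<close>

text \<open>If \<open>b = \<Sum>\<^sub>u u b\<^sub>u\<close> with all \<open>b\<^sub>u\<close> in the group algebra, this is \<open>b\<^sub>u\<close>.\<close>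

definition word_coeff ::
    "'x list \<Rightarrow> (('x, 'g) ssg_elem \<Rightarrow>\<^sub>0 'k::field) \<Rightarrow> ('x, 'g) ssg_elem \<Rightarrow>\<^sub>0 'k" where
  "word_coeff u b = (\<Sum>g\<in>{g. SEl u g [] \<in> Poly_Mapping.keys b}.
     ssg_scaled (Poly_Mapping.lookup b (SEl u g [])) (SEl [] g []))"

lemma finite_word_coeff_index: "finite {g. SEl u g [] \<in> Poly_Mapping.keys b}"
  using finite_vimageI[of "Poly_Mapping.keys b" "\<lambda>g. SEl u g []"] by (simp add: inj_def vimage_def)

context
  fixes b :: "('x, 'g) ssg_elem \<Rightarrow>\<^sub>0 'k::field"
  assumes b: "Poly_Mapping.keys b \<subseteq> {SEl u g [] | u g. g \<in> carrier G}"
begin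

lemma word_coeff_in_group_algebra: "word_coeff u b \<in> group_algebra G"
proof -
  have "Poly_Mapping.keys (word_coeff u b) \<subseteq> (\<Union>g\<in>{g. SEl u g [] \<in> Poly_Mapping.keys b}. {SEl [] g []})"
    unfolding word_coeff_def
    by (rule order_trans[OF keys_sum]) (auto simp: ssg_scaled_def split: if_splits)
  then show ?thesis using b by (fastforce simp: group_algebra_def)
qed

lemma word_coeff_closed: "word_coeff u b \<in> carrier (contracted_algebra G \<phi>)"
  using word_coeff_in_group_algebra[of u] by (fastforce simp: group_algebra_def contracted_algebra_def)

lemma sum_over_word_keys:
  fixes F :: "('x, 'g) ssg_elem \<Rightarrow> 'c::comm_monoid_add"
  assumes U: "U = {u. \<exists>g. SEl u g [] \<in> Poly_Mapping.keys b}"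
  shows "(\<Sum>s\<in>Poly_Mapping.keys b. F s) =
    (\<Sum>u\<in>U. \<Sum>g\<in>{g. SEl u g [] \<in> Poly_Mapping.keys b}. F (SEl u g []))"
proof -
  have "finite U"
  proof (rule finite_subset)
    show "U \<subseteq> (\<lambda>s. case s of SEl u g v \<Rightarrow> u | SZero \<Rightarrow> []) ` Poly_Mapping.keys b"
      by (force simp: U)
  qed simp
  then have "(\<Sum>u\<in>U. \<Sum>g\<in>{g. SEl u g [] \<in> Poly_Mapping.keys b}. F (SEl u g []))
      = (\<Sum>(u, g)\<in>Sigma U (\<lambda>u. {g. SEl u g [] \<in> Poly_Mapping.keys b}). F (SEl u g []))"
    by (intro sum.Sigma) (auto simp: finite_word_coeff_index)
  also have "\<dots> = (\<Sum>s\<in>Poly_Mapping.keys b. F s)"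
    by (rule sum.reindex_bij_witness[where j = "\<lambda>(u, g). SEl u g []"
          and i = "\<lambda>s. case s of SEl u g v \<Rightarrow> (u, g) | SZero \<Rightarrow> ([], \<one>)"])
      (use b in \<open>fastforce simp: U\<close>)+
  finally show ?thesis by simp
qed

lemma word_coeff_expansion:
  "b = (\<Sum>u\<in>{u. \<exists>g. SEl u g [] \<in> Poly_Mapping.keys b}.
    cmul G \<phi> (ssg_scaled 1 (word_elem u)) (word_coeff u b))"
proof -
  have "SZero \<notin> Poly_Mapping.keys b" using b by auto
  then have "b = (\<Sum>s\<in>Poly_Mapping.keys b. ssg_scaled (Poly_Mapping.lookup b s) s)"
    by (rule contracted_expand)
  also have "\<dots> = (\<Sum>u\<in>{u. \<exists>g. SEl u g [] \<in> Poly_Mapping.keys b}.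
      \<Sum>g\<in>{g. SEl u g [] \<in> Poly_Mapping.keys b}.
        ssg_scaled (Poly_Mapping.lookup b (SEl u g [])) (SEl u g []))"
    by (rule sum_over_word_keys) simp
  also have "\<dots> = (\<Sum>u\<in>{u. \<exists>g. SEl u g [] \<in> Poly_Mapping.keys b}.
    cmul G \<phi> (ssg_scaled 1 (word_elem u)) (word_coeff u b))"
    unfolding word_coeff_def contracted_mult_sum contracted_mult_scaled
    using b by (intro sum.cong refl) (fastforce simp: unit_simps)
  finally show ?thesis .
qed

lemma word_coeff_mult_projection:
  "cmul G \<phi> (word_coeff u b) (ssg_scaled 1 (projection y)) =
    (\<Sum>g\<in>{g. SEl u g [] \<in> Poly_Mapping.keys b}.
      ssg_scaled (Poly_Mapping.lookup b (SEl u g [])) (SEl (\<phi> g y) (word_section G \<phi> g y) y))"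
  unfolding word_coeff_def contracted_mult_sum contracted_mult_scaled
  using b by (intro sum.cong refl) (fastforce simp: unit_simps)

text \<open>
  The length of the word \<open>p\<close> is what makes the factorization \<open>u p\<close> unique, so that no other
  coefficient of \<open>b\<close> contributes to this entry.
\<close>

lemma lookup_mult_projection:
  "Poly_Mapping.lookup (cmul G \<phi> b (ssg_scaled 1 (projection y))) (SEl (u @ p) h z) =
   Poly_Mapping.lookup (cmul G \<phi> (word_coeff u b) (ssg_scaled 1 (projection y))) (SEl p h z)"
  if p: "length p = length y"
proof -
  let ?l = Poly_Mapping.lookup and ?k = "Poly_Mapping.keys b"
  let ?B = "\<lambda>v. {g. SEl v g [] \<in> ?k}"
  let ?U = "{v. \<exists>g. SEl v g [] \<in> ?k}"
  have mem: "g \<in> carrier G" if "SEl v g [] \<in> ?k" for v g using that b by auto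
  have mult: "ssg_mult G \<phi> (SEl v g []) (projection y) = SEl (v @ \<phi> g y) (word_section G \<phi> g y) y"
    if "g \<in> carrier G" for v g
    using that by (simp add: unit_simps)
  have "cmul G \<phi> b (ssg_scaled 1 (projection y))
      = (\<Sum>s\<in>?k. ssg_scaled (?l b s) (ssg_mult G \<phi> s (projection y)))"
    by (simp only: contracted_mult_scaled_right mult_1_right)
  also have "\<dots> = (\<Sum>v\<in>?U. \<Sum>g\<in>?B v.
      ssg_scaled (?l b (SEl v g [])) (ssg_mult G \<phi> (SEl v g []) (projection y)))"
    by (rule sum_over_word_keys) simp
  also have "\<dots> = (\<Sum>v\<in>?U. \<Sum>g\<in>?B v.
      Poly_Mapping.single (SEl (v @ \<phi> g y) (word_section G \<phi> g y) y) (?l b (SEl v g [])))"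
    using mem mult by (intro sum.cong refl) (auto simp: ssg_scaled_def simp del: ssg_mult.simps)
  finally have "?l (cmul G \<phi> b (ssg_scaled 1 (projection y))) (SEl (u @ p) h z)
      = (\<Sum>v\<in>?U. \<Sum>g\<in>?B v. ?l b (SEl v g []) when
          SEl (v @ \<phi> g y) (word_section G \<phi> g y) y = SEl (u @ p) h z)"
    by (simp add: lookup_sum lookup_single)
  also have "\<dots> = (\<Sum>v\<in>?U. if v = u then (\<Sum>g\<in>?B u. ?l b (SEl u g []) when
          SEl (\<phi> g y) (word_section G \<phi> g y) y = SEl p h z) else 0)"
  proof (rule sum.cong[OF refl])
    fix v
    have "v = u \<and> \<phi> g y = p" if "g \<in> carrier G" "v @ \<phi> g y = u @ p" for g
      using that p length_preserving[of g y] append_eq_append_conv[of "\<phi> g y" p v u] by auto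
    then show "(\<Sum>g\<in>?B v. ?l b (SEl v g []) when
          SEl (v @ \<phi> g y) (word_section G \<phi> g y) y = SEl (u @ p) h z)
        = (if v = u then (\<Sum>g\<in>?B u. ?l b (SEl u g []) when
          SEl (\<phi> g y) (word_section G \<phi> g y) y = SEl p h z) else 0)"
      using mem by (auto simp: when_def intro!: sum.neutral sum.cong) blast
  qed
  also have "\<dots> = (\<Sum>g\<in>?B u. ?l b (SEl u g []) when
          SEl (\<phi> g y) (word_section G \<phi> g y) y = SEl p h z)"
  proof -
    have "finite ?U"
      by (rule finite_subset[of _ "(\<lambda>s. case s of SEl u g v \<Rightarrow> u | SZero \<Rightarrow> []) ` ?k"]) force+
    moreover have "?B u = {}" if "u \<notin> ?U" using that by auto
    ultimately show ?thesis by (cases "u \<in> ?U") (simp_all add: sum.delta')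
  qed
  also have "\<dots> = ?l (\<Sum>g\<in>?B u. ssg_scaled (?l b (SEl u g []))
      (SEl (\<phi> g y) (word_section G \<phi> g y) y)) (SEl p h z)"
    by (simp add: lookup_sum lookup_single ssg_scaled_def)
  finally show ?thesis unfolding word_coeff_mult_projection .
qed

text \<open>
  The terms of \<open>b\<^sub>u y y\<^sup>*\<close> are \<open>g(y) g|\<^sub>y y\<^sup>*\<close>, and \<open>g(y)\<close> is as long as \<open>y\<close>, so by
  \<open>lookup_mult_projection\<close> each of them reappears in \<open>b y y\<^sup>*\<close>, with \<open>u\<close> put in front and with the same
  scalar.  Hence \<open>y y\<^sup>*\<close> annihilates \<open>b\<^sub>u\<close> if it annihilates \<open>b\<close>.
\<close>

lemma singular_word_coeff:
  assumes "b \<in> singular_ideal G \<phi>"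
  shows "word_coeff u b \<in> singular_ideal G \<phi>"
proof -
  have "cmul G \<phi> (word_coeff u b) (ssg_scaled 1 (projection y)) = 0"
    if y: "cmul G \<phi> b (ssg_scaled 1 (projection y)) = 0" for y
  proof (rule poly_mapping_eqI)
    fix s
    let ?c = "cmul G \<phi> (word_coeff u b) (ssg_scaled 1 (projection y))"
    have "s \<in> (\<Union>g\<in>carrier G. {SEl (\<phi> g y) (word_section G \<phi> g y) y})"
      if "s \<in> Poly_Mapping.keys ?c"
      using that b unfolding word_coeff_mult_projection
      by (fastforce dest: subsetD[OF keys_sum] simp: ssg_scaled_def split: if_splits)
    then consider "s \<notin> Poly_Mapping.keys ?c" | p h z where "s = SEl p h z" "length p = length y"
      using length_preserving by blast
    then show "Poly_Mapping.lookup ?c s = Poly_Mapping.lookup 0 s"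
    proof cases
      case 1
      then show ?thesis by (simp add: in_keys_iff)
    next
      case 2
      then show ?thesis using lookup_mult_projection[of p y u h z] y by simp
    qed
  qed
  then show ?thesis
    using assms word_coeff_closed unfolding singular_ideal_iff by blast
qed

lemma not_tight_word_coeff:
  assumes "b \<notin> tight_ideal G \<phi>"
  obtains u where "word_coeff u b \<notin> tight_ideal G \<phi>"
proof -
  interpret T: ideal "tight_ideal G \<phi>" "contracted_algebra G \<phi> :: (('x, 'g) ssg_elem \<Rightarrow>\<^sub>0 'k) ring"
    by (rule tight_ideal_is_ideal)
  have "b \<in> tight_ideal G \<phi>" if "\<And>u. word_coeff u b \<in> tight_ideal G \<phi>"
    by (subst word_coeff_expansion, rule ideal_sum_closed[OF tight_ideal_is_ideal])
      (simp add: that T.I_l_closed ssg_scaled_closed one_in_carrier)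
  then show ?thesis using assms that by blast
qed

end

end

section \<open>Singular elements of the group algebra\<close>

theorem proposition5p6:
  fixes G :: "('g, 'm) monoid_scheme"
    and \<phi> :: "'g \<Rightarrow> 'x::finite list \<Rightarrow> 'x list"
  assumes "self_similar_group G \<phi>"
    and "(singular_ideal G \<phi> :: (('x, 'g) ssg_elem \<Rightarrow>\<^sub>0 'k::field) set) - tight_ideal G \<phi> \<noteq> {}"
  shows "((singular_ideal G \<phi> :: (('x, 'g) ssg_elem \<Rightarrow>\<^sub>0 'k) set) - tight_ideal G \<phi>)
           \<inter> group_algebra G \<noteq> {}"
proof -
  interpret self_similar_group G \<phi> by fact
  obtain a :: "('x, 'g) ssg_elem \<Rightarrow>\<^sub>0 'k"
    where a: "a \<in> singular_ideal G \<phi>" "a \<notin> tight_ideal G \<phi>"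
    using assms(2) by blast
  then have carr: "a \<in> carrier (contracted_algebra G \<phi>)" by (simp add: singular_ideal_iff)
  let ?len = "\<lambda>s :: ('x, 'g) ssg_elem. case s of SEl u g v \<Rightarrow> length v | SZero \<Rightarrow> 0"
  define n where "n = Max (insert 0 (?len ` Poly_Mapping.keys a))"
  have n: "length v \<le> n" if "SEl u g v \<in> Poly_Mapping.keys a" for u g v
    unfolding n_def using that by (intro Max_ge) force+
  obtain w where w: "length w = n"
    "cmul G \<phi> a (ssg_scaled 1 (word_elem w)) \<notin> tight_ideal G \<phi>"
    using not_tight_mult_word[OF carr a(2)] by blast
  define b where "b = cmul G \<phi> a (ssg_scaled 1 (word_elem w))"
  have keys: "Poly_Mapping.keys b \<subseteq> {SEl u g [] | u g. g \<in> carrier G}"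
    unfolding b_def using n w(1) by (intro keys_mult_long_word[OF carr]) auto
  have "b \<in> singular_ideal G \<phi>" "b \<notin> tight_ideal G \<phi>"
    unfolding b_def using singular_mult_word[OF a(1)] w(2) by auto
  then obtain u where "word_coeff u b \<notin> tight_ideal G \<phi>" "word_coeff u b \<in> singular_ideal G \<phi>"
    using not_tight_word_coeff[OF keys] singular_word_coeff[OF keys] by blast
  then show ?thesis using word_coeff_in_group_algebra[OF keys] by blast
qed

end
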